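(* Let $\Theta\subsetneq\mathbb{R}^m$ be compact, let $\mathcal{G}:\Theta\to\mathbb{R}^n$ be a measurable map with range $\mathcal{R}=\mathcal{G}(\Theta)$, and let $\rho_y\in\mathcal{P}_{\mathrm{ac}}(\mathcal{R})$. Let $\rho_x^*$ be the optimizer of $$\min\left\{\int_\Theta\rho_x(x)\ln\rho_x(x)\,\mathrm{d}x\;:\;\rho_x\in\mathcal{P}_{\mathrm{ac}}(\Theta),\ \mathcal{G}_\#\rho_x=\rho_y\right\}.$$ Then $$\rho_x^*(\,\cdot\,|\,\mathcal{G}^{-1}(y))=\mathcal{U}\left(\mathcal{G}^{-1}(y)\right)\quad\text{for all }y,$$ where $\rho_x^*(\,\cdot\,|\,\mathcal{G}^{-1}(y))$ denotes the conditional distribution of $\rho_x^*$ on the set $\mathcal{G}^{-1}(y)$ and $\mathcal{U}(\mathcal{G}^{-1}(y))$ is the uniform distribution over $\mathcal{G}^{-1}(y)$. In particular, $$\rho_x^*(x)=\frac{\rho_y(\mathcal{G}(x))}{\int\delta(\mathcal{G}(x)-\mathcal{G}(x'))\,\mathrm{d}x'}.$$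
   Context: $\mathcal{P}_{\mathrm{ac}}$ denotes probability measures absolutely continuous with respect to Lebesgue measure; the same symbol denotes a measure and its Lebesgue density, and equalities of densities are understood almost everywhere. The minimization problem is assumed to be well-posed (the feasible set is nonempty and an optimizer exists). For $y\in\mathcal{R}$, $\int\delta(y-\mathcal{G}(x'))\,\mathrm{d}x'$ denotes the density at $y$ (with respect to Lebesgue measure on $\mathbb{R}^n$, assumed to exist) of the pushforward under $\mathcal{G}$ of Lebesgue measure on $\Theta$, i.e. the function $w$ with $\int_\Theta f(\mathcal{G}(x))\,\mathrm{d}x=\int f(y)w(y)\,\mathrm{d}y$ for all test functions $f$; $\int\delta(\mathcal{G}(x)-\mathcal{G}(x'))\,\mathrm{d}x'$ is $w(\mathcal{G}(x))$. Conditional distributions on the level sets $\mathcal{G}^{-1}(y)$ are those given by disintegration with respect to $\mathcal{G}$: $\rho_x^*(B)=\int\rho_x^*(B\,|\,\mathcal{G}^{-1}(y))\,\mathrm{d}\rho_y(y)$ with $\rho_x^*(\cdot|\mathcal{G}^{-1}(y))$ concentrated on $\mathcal{G}^{-1}(y)$. The uniform distribution $\mathcal{U}(\mathcal{G}^{-1}(y))$ is the conditional distribution on $\mathcal{G}^{-1}(y)$ of (normalized) Lebesgue measure on $\Theta$ in the same disintegration sense. Since disintegrations are defined up to null sets, "for all $y$" is understood for $\rho_y$-almost every $y$.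
   Formalization: The minimum value of the entropy integral is additionally assumed to be less than +∞; otherwise every feasible density is an optimizer and the claim fails (e.g. a coordinate projection of a square with ρ_y of infinite negative entropy). *)

theory Defs
  imports "HOL-Probability.Probability"
begin

text \<open>
  All measures live on the Borel sets of the ambient Euclidean space. A measure on a subset \<open>S\<close>
  is an ambient measure concentrated on \<open>S\<close>. This also covers \<open>S = G ` \<Theta>\<close>, which need not be a
  Borel set: the AE quantifier only asks the complement of \<open>S\<close> to lie in a null set.
\<close>

definition P_ac :: "'a::euclidean_space set \<Rightarrow> 'a measure set" where
  "P_ac S = {\<mu>. sets \<mu> = sets borel \<and> prob_space \<mu> \<and> absolutely_continuous lborel \<mu>
                \<and> (AE x in \<mu>. x \<in> S)}"

definition lebesgue_density :: "'a::euclidean_space measure \<Rightarrow> 'a \<Rightarrow> real" where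
  "lebesgue_density \<mu> x = enn2real (RN_deriv lborel \<mu> x)"

text \<open>The restriction to \<open>\<Theta>\<close> is needed because only the values of \<open>G\<close> on \<open>\<Theta>\<close> are meaningful.\<close>

definition pushforward ::
  "'a::euclidean_space set \<Rightarrow> ('a \<Rightarrow> 'b::euclidean_space) \<Rightarrow> 'a measure \<Rightarrow> 'b measure" where
  "pushforward \<Theta> G \<mu> = distr (restrict_space \<mu> \<Theta>) borel G"

text \<open>
  The integral of \<open>\<rho> ln \<rho>\<close> over \<open>\<Theta>\<close> with values in the extended reals, as positive part minus
  negative part (a Bochner integral would assign 0 to a non-integrable \<open>\<rho> ln \<rho>\<close>). Since
  \<open>t ln t \<ge> -1/e\<close>, the negative part is finite whenever \<open>\<Theta>\<close> has finite Lebesgue measure, so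
  \<open>\<infinity> - \<infinity>\<close> does not occur for compact \<open>\<Theta>\<close>. The convention \<open>0 ln 0 = 0\<close> holds automatically.
\<close>

definition neg_entropy :: "'a::euclidean_space set \<Rightarrow> 'a measure \<Rightarrow> ereal" where
  "neg_entropy \<Theta> \<rho> =
     enn2ereal (\<integral>\<^sup>+x\<in>\<Theta>. ennreal (lebesgue_density \<rho> x * ln (lebesgue_density \<rho> x)) \<partial>lborel)
   - enn2ereal (\<integral>\<^sup>+x\<in>\<Theta>. ennreal (- (lebesgue_density \<rho> x * ln (lebesgue_density \<rho> x))) \<partial>lborel)"

definition feasible ::
  "'a::euclidean_space set \<Rightarrow> ('a \<Rightarrow> 'b::euclidean_space) \<Rightarrow> 'b measure \<Rightarrow> 'a measure \<Rightarrow> bool" where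
  "feasible \<Theta> G \<rho>y \<rho>x \<longleftrightarrow> \<rho>x \<in> P_ac \<Theta> \<and> pushforward \<Theta> G \<rho>x = \<rho>y"

text \<open>
  \<open>\<kappa>\<close> is a version of the family of conditional distributions of \<open>\<mu>\<close> on the level sets of \<open>G\<close>.
  Such a family is only determined up to null sets of the pushforward of \<open>\<mu>\<close>; in particular
  \<open>\<kappa> y\<close> is an arbitrary probability measure when the level set of \<open>y\<close> is empty.
\<close>

definition disintegration ::
  "'a::euclidean_space set \<Rightarrow> ('a \<Rightarrow> 'b::euclidean_space) \<Rightarrow> 'a measure \<Rightarrow> ('b \<Rightarrow> 'a measure) \<Rightarrow> bool"
where
  "disintegration \<Theta> G \<mu> \<kappa> \<longleftrightarrow>
     \<kappa> \<in> borel \<rightarrow>\<^sub>M prob_algebra borel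
   \<and> (AE y in pushforward \<Theta> G \<mu>. AE x in \<kappa> y. x \<in> \<Theta> \<and> G x = y)
   \<and> (\<forall>B\<in>sets borel. emeasure \<mu> B = (\<integral>\<^sup>+y. emeasure (\<kappa> y) B \<partial>pushforward \<Theta> G \<mu>))"

text \<open>
  A version of the uniform distributions on the level sets of \<open>G\<close>: the conditional distributions
  of normalized Lebesgue measure on \<open>\<Theta>\<close>.
\<close>

definition uniform_on_level_sets ::
  "'a::euclidean_space set \<Rightarrow> ('a \<Rightarrow> 'b::euclidean_space) \<Rightarrow> ('b \<Rightarrow> 'a measure) \<Rightarrow> bool" where
  "uniform_on_level_sets \<Theta> G U \<longleftrightarrow> disintegration \<Theta> G (uniform_measure lborel \<Theta>) U"

text \<open>
  \<open>level_density \<Theta> G y\<close> is the integral over \<open>x' \<in> \<Theta>\<close> of \<open>\<delta>(y - G x')\<close>. It is meaningful only if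
  the pushforward of Lebesgue measure on \<open>\<Theta>\<close> is absolutely continuous.
\<close>

definition level_density ::
  "'a::euclidean_space set \<Rightarrow> ('a \<Rightarrow> 'b::euclidean_space) \<Rightarrow> 'b \<Rightarrow> real" where
  "level_density \<Theta> G = lebesgue_density (pushforward \<Theta> G lborel)"

end

theory Submission imports Defs begin

text \<open>
  Write \<open>\<lambda>\<close> for Lebesgue measure on \<open>\<Theta>\<close>, \<open>\<nu>\<close> for its image under \<open>G\<close>, and \<open>f\<close> for the density of the
  optimizer. A feasible measure has image \<open>\<rho>\<^sub>y\<close>, so \<open>\<rho>\<^sub>y\<close> has a density \<open>h\<close> with respect to \<open>\<nu>\<close>, and
  \<open>h\<close> is the conditional expectation of \<open>f\<close> given \<open>G\<close>. Replacing \<open>f\<close> by \<open>h \<circ> G\<close> keeps the image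
  measure and, by strict convexity of \<open>t ln t\<close>, lowers the integral of \<open>f ln f\<close> unless \<open>f = h \<circ> G\<close>
  already. So the optimal density is constant on the level sets of \<open>G\<close>.

  The difficulty in this argument is integrability: nothing is known in advance about \<open>h ln h\<close>. It
  disappears if \<open>f\<close> is replaced only above a band \<open>\<epsilon> \<le> h \<le> K\<close>, where \<open>ln h\<close> is bounded. The constraint
  still holds, because it is a condition on each set of values of \<open>G\<close> separately, and the integral of
  \<open>f ln f\<close> drops exactly by the integral over the band of the pointwise Gibbs gap \<open>f ln f - f ln h - f + h\<close>. Optimality
  forces this integral to vanish (\<open>entropy_minimizer_on_band\<close>), and countably many bands exhaust
  \<open>{h > 0}\<close>; where \<open>h = 0\<close>, the constraint itself gives \<open>f = 0\<close> (\<open>entropy_minimizer_factors\<close>).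

  Both conclusions follow from \<open>f = h \<circ> G\<close>. A weight that depends on \<open>G x\<close> only cancels in the
  normalization of each conditional distribution, so the optimizer and the normalized Lebesgue measure
  have the same disintegration (\<open>disintegration_density_unique\<close>). If \<open>\<nu>\<close> has Lebesgue density \<open>w\<close>, then
  \<open>\<rho>\<^sub>y\<close> has Lebesgue density \<open>w h\<close>, so \<open>h\<close> is the quotient of the two densities wherever \<open>w > 0\<close>,
  that is, \<open>\<nu>\<close>-almost everywhere.
\<close>

section \<open>Entropy minimization along a fixed map\<close>

text \<open>
  The tangent inequality \<open>ln s \<le> s - 1\<close>, with equality only at \<open>s = 1\<close>, for \<open>s = b / a\<close>. The linear
  terms make the gap pointwise nonnegative; they integrate to zero when \<open>a\<close> and \<open>b\<close> have equal mass.
\<close>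

lemma gibbs_pointwise:
  fixes a b :: real
  assumes "0 \<le> a" "0 < b"
  shows "0 \<le> a * ln a - a * ln b - a + b"
    and "a * ln a - a * ln b - a + b = 0 \<Longrightarrow> a = b"
proof -
  have *: "0 \<le> a * ln a - a * ln b - a + b \<and> (a * ln a - a * ln b - a + b = 0 \<longrightarrow> a = b)"
  proof (cases "a = 0")
    case True
    with assms show ?thesis by simp
  next
    case False
    with assms have a: "0 < a" by simp
    have "a * ln (b / a) = a * ln b - a * ln a"
      using a assms by (simp add: ln_div algebra_simps)
    moreover have "a * (b / a - 1) = b - a"
      using a by (simp add: field_simps)
    ultimately have eq: "a * ln a - a * ln b - a + b = a * ((b / a - 1) - ln (b / a))"
      by (simp add: algebra_simps)
    have pos: "0 < b / a" using a assms by simp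
    have "0 \<le> a * ((b / a - 1) - ln (b / a))"
      using ln_le_minus_one[OF pos] a by simp
    moreover have "a = b" if "a * ((b / a - 1) - ln (b / a)) = 0"
    proof -
      have "ln (b / a) = b / a - 1" using that a by simp
      then have "b / a = 1" using ln_eq_minus_one[OF pos] by simp
      then show "a = b" using a by simp
    qed
    ultimately show ?thesis unfolding eq by blast
  qed
  show "0 \<le> a * ln a - a * ln b - a + b" using * by blast
  show "a * ln a - a * ln b - a + b = 0 \<Longrightarrow> a = b" using * by blast
qed

text \<open>
  The hypothesis on the image measure says that \<open>h \<circ> T\<close> is the conditional expectation of \<open>f\<close> given
  \<open>T\<close>: the two weights cannot be told apart by functions of \<open>T\<close>.
\<close>

lemma nn_integral_pushed_weight:
  fixes f :: "'a \<Rightarrow> real" and h :: "'b \<Rightarrow> real"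
  assumes T[measurable]: "T \<in> M \<rightarrow>\<^sub>M N"
    and f[measurable]: "f \<in> borel_measurable M"
    and h[measurable]: "h \<in> borel_measurable N"
    and push: "distr (density M f) N T = density (distr M N T) h"
    and \<phi>[measurable]: "\<phi> \<in> borel_measurable N"
  shows "(\<integral>\<^sup>+x. ennreal (f x) * \<phi> (T x) \<partial>M) = (\<integral>\<^sup>+x. ennreal (h (T x)) * \<phi> (T x) \<partial>M)"
proof -
  have "(\<integral>\<^sup>+x. ennreal (f x) * \<phi> (T x) \<partial>M) = (\<integral>\<^sup>+y. \<phi> y \<partial>distr (density M f) N T)"
    by (subst nn_integral_distr) (auto simp: nn_integral_density)
  also have "\<dots> = (\<integral>\<^sup>+x. ennreal (h (T x)) * \<phi> (T x) \<partial>M)"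
    unfolding push by (subst nn_integral_density) (auto simp: nn_integral_distr)
  finally show ?thesis .
qed

lemma integral_pushed_weight:
  fixes f :: "'a \<Rightarrow> real" and h \<phi> :: "'b \<Rightarrow> real"
  assumes T[measurable]: "T \<in> M \<rightarrow>\<^sub>M N"
    and f[measurable]: "f \<in> borel_measurable M" and f0: "\<And>x. 0 \<le> f x"
    and h[measurable]: "h \<in> borel_measurable N" and h0: "\<And>y. 0 \<le> h y"
    and push: "distr (density M f) N T = density (distr M N T) h"
    and \<phi>[measurable]: "\<phi> \<in> borel_measurable N"
  shows "(\<integral>x. f x * \<phi> (T x) \<partial>M) = (\<integral>x. h (T x) * \<phi> (T x) \<partial>M)"
proof -
  have "(\<integral>x. f x * \<phi> (T x) \<partial>M) = (\<integral>y. \<phi> y \<partial>distr (density M f) N T)"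
    using f0 by (subst integral_distr) (auto simp: integral_density)
  also have "\<dots> = (\<integral>x. h (T x) * \<phi> (T x) \<partial>M)"
    using h0 unfolding push by (subst integral_density) (auto simp: integral_distr)
  finally show ?thesis .
qed

text \<open>
  The competitor \<open>g\<close> equals \<open>h \<circ> T\<close> above the band and \<open>f\<close> elsewhere. On the band \<open>h\<close> and \<open>ln h\<close> are
  bounded, so every term of the Gibbs gap is integrable on its own and the gap integrates to the
  difference of the integrals of \<open>f ln f\<close> and \<open>g ln g\<close>.
\<close>

lemma entropy_minimizer_on_band:
  fixes f :: "'a \<Rightarrow> real" and h :: "'b \<Rightarrow> real"
  assumes "finite_measure M"
    and T[measurable]: "T \<in> M \<rightarrow>\<^sub>M N"
    and f[measurable]: "f \<in> borel_measurable M" and f0: "\<And>x. 0 \<le> f x"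
    and f_int: "integrable M f"
    and ent: "integrable M (\<lambda>x. f x * ln (f x))"
    and h[measurable]: "h \<in> borel_measurable N" and h0: "\<And>y. 0 \<le> h y"
    and push: "distr (density M f) N T = density (distr M N T) h"
    and minimal: "\<And>g. \<lbrakk>g \<in> borel_measurable M; \<And>x. 0 \<le> g x; integrable M (\<lambda>x. g x * ln (g x));
        distr (density M g) N T = distr (density M f) N T\<rbrakk>
        \<Longrightarrow> (\<integral>x. f x * ln (f x) \<partial>M) \<le> (\<integral>x. g x * ln (g x) \<partial>M)"
    and \<epsilon>: "0 < \<epsilon>"
  shows "AE x in M. h (T x) \<in> {\<epsilon>..K} \<longrightarrow> f x = h (T x)"
proof -
  interpret finite_measure M by fact
  define b :: "'b \<Rightarrow> real" where "b y = indicator {\<epsilon>..K} (h y)" for y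
  have b[measurable]: "b \<in> borel_measurable N" unfolding b_def by measurable
  have b01: "b y = (if h y \<in> {\<epsilon>..K} then 1 else 0)" for y unfolding b_def by simp
  define g where "g x = (1 - b (T x)) * f x + b (T x) * h (T x)" for x
  have g[measurable]: "g \<in> borel_measurable M" unfolding g_def by measurable
  have g0: "0 \<le> g x" for x using f0 h0 by (simp add: g_def b01)

  define C where "C = \<bar>ln \<epsilon>\<bar> + \<bar>ln K\<bar>"
  have bln: "\<bar>b y * ln (h y)\<bar> \<le> C" for y
  proof (cases "h y \<in> {\<epsilon>..K}")
    case True
    then have "ln \<epsilon> \<le> ln (h y)" "ln (h y) \<le> ln K" using \<epsilon> by auto
    then show ?thesis using True unfolding C_def b01 by auto
  next
    case False
    then show ?thesis unfolding C_def b01 by (subst if_not_P) auto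
  qed
  have int_ff: "integrable M (\<lambda>x. b (T x) * (f x * ln (f x)))"
    by (rule Bochner_Integration.integrable_bound[OF ent]) (auto simp: b01)
  have int_fh: "integrable M (\<lambda>x. f x * (b (T x) * ln (h (T x))))"
  proof (rule Bochner_Integration.integrable_bound[of M "\<lambda>x. C * f x"])
    show "AE x in M. norm (f x * (b (T x) * ln (h (T x)))) \<le> norm (C * f x)"
    proof (rule AE_I2)
      fix x
      have "f x * \<bar>b (T x) * ln (h (T x))\<bar> \<le> f x * C"
        using bln f0 by (intro mult_left_mono) auto
      moreover have "0 \<le> C" unfolding C_def by simp
      ultimately show "norm (f x * (b (T x) * ln (h (T x)))) \<le> norm (C * f x)"
        using f0[of x] by (simp add: abs_mult mult.commute)
    qed
  qed (use f_int in auto)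
  have bh: "\<bar>b y * h y\<bar> \<le> \<bar>K\<bar>" for y using h0[of y] by (auto simp: b01)
  have int_h: "integrable M (\<lambda>x. h (T x) * b (T x))"
    by (rule integrable_const_bound[of _ "\<bar>K\<bar>"]) (use bh in \<open>auto simp: mult.commute\<close>)
  have int_f: "integrable M (\<lambda>x. f x * b (T x))"
    by (rule Bochner_Integration.integrable_bound[OF f_int]) (auto simp: b01)
  have int_hh: "integrable M (\<lambda>x. h (T x) * (b (T x) * ln (h (T x))))"
  proof (rule integrable_const_bound[of _ "\<bar>K\<bar> * C"])
    show "AE x in M. norm (h (T x) * (b (T x) * ln (h (T x)))) \<le> \<bar>K\<bar> * C"
    proof (rule AE_I2)
      fix x
      have "\<bar>b (T x) * h (T x)\<bar> * \<bar>b (T x) * ln (h (T x))\<bar> \<le> \<bar>K\<bar> * C"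
        using bh bln by (intro mult_mono) auto
      then show "norm (h (T x) * (b (T x) * ln (h (T x)))) \<le> \<bar>K\<bar> * C"
        by (auto simp: abs_mult b01 split: if_splits)
    qed
  qed auto
  note swap = integral_pushed_weight[OF T f f0 h h0 push]
  have swap_ln: "(\<integral>x. f x * (b (T x) * ln (h (T x))) \<partial>M) = (\<integral>x. h (T x) * (b (T x) * ln (h (T x))) \<partial>M)"
    by (rule swap) measurable
  have swap_1: "(\<integral>x. f x * b (T x) \<partial>M) = (\<integral>x. h (T x) * b (T x) \<partial>M)"
    by (rule swap) measurable

  have g_ent_eq: "g x * ln (g x)
      = f x * ln (f x) - b (T x) * (f x * ln (f x)) + h (T x) * (b (T x) * ln (h (T x)))" for x
    by (simp add: g_def b01)
  have g_ent: "integrable M (\<lambda>x. g x * ln (g x))"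
    unfolding g_ent_eq using ent int_ff int_hh by auto
  have g_val: "(\<integral>x. g x * ln (g x) \<partial>M) = (\<integral>x. f x * ln (f x) \<partial>M)
      - (\<integral>x. b (T x) * (f x * ln (f x)) \<partial>M) + (\<integral>x. h (T x) * (b (T x) * ln (h (T x))) \<partial>M)"
    unfolding g_ent_eq using ent int_ff int_hh by simp

  \<comment> \<open>The mass that \<open>g\<close> puts above the band equals that of \<open>f\<close>, for each set of values of \<open>T\<close>.\<close>
  have g_push: "distr (density M g) N T = distr (density M f) N T"
  proof (rule measure_eqI)
    fix A assume "A \<in> sets (distr (density M g) N T)"
    then have A[measurable]: "A \<in> sets N" by simp
    have em: "emeasure (distr (density M k) N T) A = (\<integral>\<^sup>+x. ennreal (k x) * indicator A (T x) \<partial>M)"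
      if [measurable]: "k \<in> borel_measurable M" for k :: "'a \<Rightarrow> real"
    proof -
      have "emeasure (distr (density M k) N T) A = (\<integral>\<^sup>+y. indicator A y \<partial>distr (density M k) N T)"
        by simp
      also have "\<dots> = (\<integral>\<^sup>+x. ennreal (k x) * indicator A (T x) \<partial>M)"
        by (subst nn_integral_distr) (auto simp: nn_integral_density)
      finally show ?thesis .
    qed
    have "(\<integral>\<^sup>+x. ennreal (g x) * indicator A (T x) \<partial>M)
      = (\<integral>\<^sup>+x. ennreal (f x) * (ennreal (1 - b (T x)) * indicator A (T x))
             + ennreal (h (T x)) * (ennreal (b (T x)) * indicator A (T x)) \<partial>M)"
      by (intro nn_integral_cong) (simp add: g_def b01)
    also have "\<dots> = (\<integral>\<^sup>+x. ennreal (f x) * (ennreal (1 - b (T x)) * indicator A (T x)) \<partial>M)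
             + (\<integral>\<^sup>+x. ennreal (h (T x)) * (ennreal (b (T x)) * indicator A (T x)) \<partial>M)"
      by (rule nn_integral_add) measurable
    also have "(\<integral>\<^sup>+x. ennreal (h (T x)) * (ennreal (b (T x)) * indicator A (T x)) \<partial>M)
        = (\<integral>\<^sup>+x. ennreal (f x) * (ennreal (b (T x)) * indicator A (T x)) \<partial>M)"
      by (rule nn_integral_pushed_weight[OF T f h push, symmetric]) measurable
    also have "(\<integral>\<^sup>+x. ennreal (f x) * (ennreal (1 - b (T x)) * indicator A (T x)) \<partial>M)
             + (\<integral>\<^sup>+x. ennreal (f x) * (ennreal (b (T x)) * indicator A (T x)) \<partial>M)
        = (\<integral>\<^sup>+x. ennreal (f x) * (ennreal (1 - b (T x)) * indicator A (T x))
             + ennreal (f x) * (ennreal (b (T x)) * indicator A (T x)) \<partial>M)"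
      by (rule nn_integral_add[symmetric]) measurable
    also have "\<dots> = (\<integral>\<^sup>+x. ennreal (f x) * indicator A (T x) \<partial>M)"
      by (intro nn_integral_cong) (simp add: b01)
    finally show "emeasure (distr (density M g) N T) A = emeasure (distr (density M f) N T) A"
      by (simp add: em)
  qed simp

  \<comment> \<open>The Gibbs gap between \<open>f\<close> and \<open>h \<circ> T\<close>, cut off to the band. Since \<open>ln h\<close> and the constant 1 are
    functions of \<open>T\<close>, they may be integrated against \<open>h \<circ> T\<close> instead of \<open>f\<close>; this turns the integral
    of the gap into the difference of the objective values of \<open>f\<close> and \<open>g\<close>.\<close>
  define D where "D x = b (T x) * (f x * ln (f x)) - f x * (b (T x) * ln (h (T x)))
      - f x * b (T x) + h (T x) * b (T x)" for x
  have D_eq: "D x = b (T x) * (f x * ln (f x) - f x * ln (h (T x)) - f x + h (T x))" for x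
    by (simp add: D_def algebra_simps)
  have D0: "0 \<le> D x" for x
  proof (cases "h (T x) \<in> {\<epsilon>..K}")
    case True
    then have "0 < h (T x)" using \<epsilon> by auto
    from gibbs_pointwise(1)[OF f0[of x] this] show ?thesis unfolding D_eq by (simp add: b01)
  next
    case False
    then show ?thesis unfolding D_eq b01 by (subst if_not_P) auto
  qed
  have D_int: "integrable M D"
    unfolding D_def using int_ff int_fh int_f int_h by auto
  have "(\<integral>x. D x \<partial>M) = (\<integral>x. f x * ln (f x) \<partial>M) - (\<integral>x. g x * ln (g x) \<partial>M)"
    unfolding D_def g_val using int_ff int_fh int_f int_h swap_ln swap_1 by simp
  also have "\<dots> \<le> 0" using minimal[OF g g0 g_ent g_push] by simp
  finally have "(\<integral>x. D x \<partial>M) = 0"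
    using Bochner_Integration.integral_nonneg[of M D] D0 by (simp add: order_antisym)
  then have "AE x in M. D x = 0"
    using integral_nonneg_eq_0_iff_AE[OF D_int] D0 by simp
  then show ?thesis
  proof eventually_elim
    case (elim x)
    show ?case
    proof
      assume h_in: "h (T x) \<in> {\<epsilon>..K}"
      then have "0 < h (T x)" using \<epsilon> by auto
      from gibbs_pointwise(2)[OF f0[of x] this] elim h_in show "f x = h (T x)"
        unfolding D_eq by (simp add: b01)
    qed
  qed
qed

text \<open>
  The bands \<open>1 / (k + 1) \<le> h \<le> k\<close> cover \<open>{h > 0}\<close>. No mass of \<open>f\<close> lies above \<open>{h = 0}\<close>, because that
  set is null for the prescribed image measure.
\<close>

theorem entropy_minimizer_factors:
  fixes f :: "'a \<Rightarrow> real" and h :: "'b \<Rightarrow> real"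
  assumes fin: "finite_measure M"
    and T[measurable]: "T \<in> M \<rightarrow>\<^sub>M N"
    and f[measurable]: "f \<in> borel_measurable M" and f0: "\<And>x. 0 \<le> f x"
    and f_int: "integrable M f"
    and ent: "integrable M (\<lambda>x. f x * ln (f x))"
    and h[measurable]: "h \<in> borel_measurable N" and h0: "\<And>y. 0 \<le> h y"
    and push: "distr (density M f) N T = density (distr M N T) h"
    and minimal: "\<And>g. \<lbrakk>g \<in> borel_measurable M; \<And>x. 0 \<le> g x; integrable M (\<lambda>x. g x * ln (g x));
        distr (density M g) N T = distr (density M f) N T\<rbrakk>
        \<Longrightarrow> (\<integral>x. f x * ln (f x) \<partial>M) \<le> (\<integral>x. g x * ln (g x) \<partial>M)"
  shows "AE x in M. f x = h (T x)"
proof -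
  have "AE x in M. \<forall>k::nat. h (T x) \<in> {inverse (real (Suc k))..real k} \<longrightarrow> f x = h (T x)"
    unfolding AE_all_countable
    by (intro allI entropy_minimizer_on_band[OF fin T f f0 f_int ent h h0 push minimal]) simp_all
  moreover have "AE x in M. h (T x) = 0 \<longrightarrow> f x = 0"
  proof -
    have "(\<integral>\<^sup>+x. ennreal (f x) * indicator {0} (h (T x)) \<partial>M)
        = (\<integral>\<^sup>+x. ennreal (h (T x)) * indicator {0} (h (T x)) \<partial>M)"
      by (rule nn_integral_pushed_weight[OF T f h push]) measurable
    also have "\<dots> = (\<integral>\<^sup>+x. 0 \<partial>M)"
      by (intro nn_integral_cong) (simp split: split_indicator)
    finally have "AE x in M. ennreal (f x) * indicator {0} (h (T x)) = 0"
      using nn_integral_0_iff_AE[of "\<lambda>x. ennreal (f x) * indicator {0} (h (T x))" M] by simp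
    then show ?thesis
      by eventually_elim (use f0 in \<open>auto simp: order_antisym\<close>)
  qed
  ultimately show ?thesis
  proof eventually_elim
    case (elim x)
    show ?case
    proof (cases "h (T x) = 0")
      case False
      with h0[of "T x"] have pos: "0 < h (T x)" by simp
      obtain k1 where k1: "inverse (real (Suc k1)) < h (T x)"
        using reals_Archimedean[OF pos] by blast
      obtain k2 :: nat where k2: "h (T x) \<le> real k2" using real_arch_simple by blast
      have "inverse (real (Suc (max k1 k2))) \<le> inverse (real (Suc k1))"
        by (intro le_imp_inverse_le) auto
      with k1 have "inverse (real (Suc (max k1 k2))) \<le> h (T x)" by linarith
      moreover have "h (T x) \<le> real (max k1 k2)" using k2 by linarith
      ultimately have "h (T x) \<in> {inverse (real (Suc (max k1 k2)))..real (max k1 k2)}" by simp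
      with elim(1) show ?thesis by blast
    qed (use elim in simp)
  qed
qed

section \<open>Uniqueness of disintegrations\<close>

lemma countable_Int_stable_generator_borel:
  obtains E :: "'a::second_countable_topology set set"
  where "countable E" "Int_stable E" "UNIV \<in> E" "sets borel = sigma_sets UNIV E"
proof -
  obtain B :: "'a set set" where B: "countable B" "topological_basis B"
    using ex_countable_basis by blast
  define E where "E = Inter ` {F. finite F \<and> F \<subseteq> B}"
  have "countable E" unfolding E_def using countable_Collect_finite_subset[OF B(1)]
    by (simp add: conj_commute)
  moreover have "Int_stable E"
  proof (rule Int_stableI)
    fix a b assume "a \<in> E" "b \<in> E"
    then obtain F1 F2 where "finite F1" "F1 \<subseteq> B" "a = \<Inter>F1" "finite F2" "F2 \<subseteq> B" "b = \<Inter>F2"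
      unfolding E_def by auto
    then show "a \<inter> b \<in> E" unfolding E_def
      by (intro image_eqI[of _ _ "F1 \<union> F2"]) auto
  qed
  moreover have "UNIV \<in> E" unfolding E_def by (intro image_eqI[of _ _ "{}"]) auto
  moreover have "sets borel = sigma_sets UNIV E"
  proof
    have "B \<subseteq> E"
    proof
      fix b assume "b \<in> B"
      then show "b \<in> E" unfolding E_def by (intro image_eqI[of _ _ "{b}"]) simp_all
    qed
    moreover have "sets (borel :: 'a measure) = sigma_sets UNIV B"
      by (simp add: borel_eq_countable_basis[OF B])
    ultimately show "sets borel \<subseteq> sigma_sets UNIV E" by (simp add: sigma_sets_mono')
    have "open a" if "a \<in> E" for a
    proof -
      obtain F where "finite F" "F \<subseteq> B" "a = \<Inter>F"
        using \<open>a \<in> E\<close> unfolding E_def by blast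
      then have "\<forall>T\<in>F. open T" using topological_basis_open[OF B(2)] by (meson subsetD)
      with \<open>finite F\<close> show ?thesis unfolding \<open>a = \<Inter>F\<close> by (rule open_Inter)
    qed
    then have "E \<subseteq> sets borel" by auto
    then show "sigma_sets UNIV E \<subseteq> sets borel"
      using sets.sigma_sets_subset[of E borel] by simp
  qed
  ultimately show thesis using that by blast
qed

text \<open>
  For each fixed set the two kernels agree almost everywhere, with an exceptional set that depends on
  the set. A countable generator makes the exceptional sets a single null set.
\<close>

lemma AE_kernels_eqI:
  fixes \<kappa> U :: "'b \<Rightarrow> 'a::second_countable_topology measure"
  assumes fin: "finite_measure \<nu>"
    and \<kappa>[measurable]: "\<kappa> \<in> \<nu> \<rightarrow>\<^sub>M prob_algebra borel"
    and U[measurable]: "U \<in> \<nu> \<rightarrow>\<^sub>M prob_algebra borel"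
    and eq: "\<And>B C. B \<in> sets borel \<Longrightarrow> C \<in> sets \<nu> \<Longrightarrow>
      (\<integral>\<^sup>+y. emeasure (\<kappa> y) B * indicator C y \<partial>\<nu>) = (\<integral>\<^sup>+y. emeasure (U y) B * indicator C y \<partial>\<nu>)"
  shows "AE y in \<nu>. \<kappa> y = U y"
proof -
  interpret finite_measure \<nu> by fact
  obtain E :: "'a set set" where E: "countable E" "Int_stable E" "UNIV \<in> E"
    "sets borel = sigma_sets UNIV E"
    by (rule countable_Int_stable_generator_borel)
  have "AE y in \<nu>. emeasure (\<kappa> y) B = emeasure (U y) B" if "B \<in> E" for B
  proof -
    have B[measurable]: "B \<in> sets borel" using that E(4) by auto
    have [measurable]: "(\<lambda>y. emeasure (\<kappa> y) B) \<in> borel_measurable \<nu>"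
      "(\<lambda>y. emeasure (U y) B) \<in> borel_measurable \<nu>"
      using measurable_prob_algebraD[OF \<kappa>] measurable_prob_algebraD[OF U] B
      by (auto intro: measurable_emeasure_kernel)
    have "density \<nu> (\<lambda>y. emeasure (\<kappa> y) B) = density \<nu> (\<lambda>y. emeasure (U y) B)"
      by (rule measure_eqI) (auto simp: emeasure_density eq)
    then show ?thesis by (rule density_unique[rotated 2]) measurable
  qed
  then have "AE y in \<nu>. \<forall>B\<in>E. emeasure (\<kappa> y) B = emeasure (U y) B"
    using E(1) by (simp add: AE_ball_countable)
  then show ?thesis
    using AE_space
  proof eventually_elim
    case (elim y)
    have "\<kappa> y \<in> space (prob_algebra borel)" "U y \<in> space (prob_algebra borel)"
      using elim(2) measurable_space[OF \<kappa>] measurable_space[OF U] by auto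
    then have *: "prob_space (\<kappa> y)" "sets (\<kappa> y) = sets borel" "sets (U y) = sets borel"
      by (auto simp: space_prob_algebra)
    interpret \<kappa>: prob_space "\<kappa> y" by fact
    show ?case
      by (rule measure_eqI_generator_eq[of E UNIV _ _ "\<lambda>_. UNIV"]) (use E elim * in auto)
  qed
qed

text \<open>
  Functions of \<open>G\<close> can be pulled out of the inner integral, because \<open>\<kappa> y\<close> lives on the level set of \<open>y\<close>.
\<close>

lemma nn_integral_disintegration:
  assumes \<Theta>[measurable]: "\<Theta> \<in> sets borel"
    and G: "G \<in> restrict_space borel \<Theta> \<rightarrow>\<^sub>M borel"
    and \<mu>: "sets \<mu> = sets borel"
    and dis: "disintegration \<Theta> G \<mu> \<kappa>"
    and B[measurable]: "B \<in> sets borel"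
    and k[measurable]: "k \<in> borel_measurable borel"
  shows "(\<integral>\<^sup>+x. indicator (B \<inter> \<Theta>) x * k (G x) \<partial>\<mu>)
      = (\<integral>\<^sup>+y. emeasure (\<kappa> y) B * k y \<partial>pushforward \<Theta> G \<mu>)"
proof -
  let ?\<nu> = "pushforward \<Theta> G \<mu>"
  have \<nu>: "sets ?\<nu> = sets borel" "space ?\<nu> = UNIV" by (simp_all add: pushforward_def)
  have \<kappa>: "\<kappa> \<in> borel \<rightarrow>\<^sub>M prob_algebra borel"
    and conc: "AE y in ?\<nu>. AE x in \<kappa> y. x \<in> \<Theta> \<and> G x = y"
    and mix: "\<And>B. B \<in> sets borel \<Longrightarrow> emeasure \<mu> B = (\<integral>\<^sup>+y. emeasure (\<kappa> y) B \<partial>?\<nu>)"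
    using dis unfolding disintegration_def by auto
  have \<kappa>': "\<kappa> \<in> ?\<nu> \<rightarrow>\<^sub>M subprob_algebra borel"
    using measurable_prob_algebraD[OF \<kappa>] by (simp add: \<nu> cong: measurable_cong_sets)
  have \<mu>_bind: "\<mu> = bind ?\<nu> \<kappa>"
    by (rule measure_eqI) (auto simp: \<mu> \<nu> sets_bind[OF sets_kernel[OF \<kappa>']] emeasure_bind[OF _ \<kappa>'] mix)
  have \<kappa>_sp: "prob_space (\<kappa> y)" "sets (\<kappa> y) = sets borel" for y
    using measurable_space[OF \<kappa>, of y] by (auto simp: space_prob_algebra)
  have G'[measurable]: "(\<lambda>x. indicator \<Theta> x * k (G x)) \<in> borel_measurable borel"
  proof -
    have "(\<lambda>x. k (G x)) \<in> borel_measurable (restrict_space borel \<Theta>)"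
      using measurable_compose[OF G k] .
    then show ?thesis by (subst (asm) borel_measurable_restrict_space_iff_ennreal) (auto simp: mult.commute)
  qed
  have eq: "indicator (B \<inter> \<Theta>) x * k (G x) = indicator B x * (indicator \<Theta> x * k (G x))" for x
    by (simp split: split_indicator)
  have "(\<integral>\<^sup>+x. indicator (B \<inter> \<Theta>) x * k (G x) \<partial>\<mu>)
      = (\<integral>\<^sup>+y. (\<integral>\<^sup>+x. indicator (B \<inter> \<Theta>) x * k (G x) \<partial>\<kappa> y) \<partial>?\<nu>)"
    unfolding eq
    by (subst \<mu>_bind, rule nn_integral_bind[OF _ \<kappa>']) measurable
  also have "\<dots> = (\<integral>\<^sup>+y. emeasure (\<kappa> y) B * k y \<partial>?\<nu>)"
  proof (rule nn_integral_cong_AE, use conc in eventually_elim)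
    case (elim y)
    have [measurable]: "B \<in> sets (\<kappa> y)" by (simp add: \<kappa>_sp B)
    have "(\<integral>\<^sup>+x. indicator (B \<inter> \<Theta>) x * k (G x) \<partial>\<kappa> y) = (\<integral>\<^sup>+x. k y * indicator B x \<partial>\<kappa> y)"
      by (rule nn_integral_cong_AE, use elim in eventually_elim) (auto split: split_indicator)
    also have "\<dots> = emeasure (\<kappa> y) B * k y"
      by (simp add: nn_integral_cmult mult.commute)
    finally show ?case .
  qed
  finally show ?thesis .
qed

text \<open>
  If \<open>\<rho>\<close> has density \<open>q \<circ> G\<close> with respect to \<open>\<mu>\<close> on \<open>\<Theta>\<close>, then its image has density \<open>q\<close> with respect
  to the image of \<open>\<mu>\<close>. Thus the weight is entirely absorbed by the image measure, and a disintegration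
  of \<open>\<mu>\<close> is also one of \<open>\<rho>\<close>. For \<open>q = 1\<close> this is the uniqueness of disintegrations.
\<close>

theorem disintegration_density_unique:
  assumes \<Theta>[measurable]: "\<Theta> \<in> sets borel"
    and G: "G \<in> restrict_space borel \<Theta> \<rightarrow>\<^sub>M borel"
    and \<mu>: "sets \<mu> = sets borel" and \<rho>: "sets \<rho> = sets borel"
    and fin: "finite_measure (pushforward \<Theta> G \<rho>)"
    and q[measurable]: "q \<in> borel_measurable borel"
    and \<rho>_eq: "\<And>B. B \<in> sets borel \<Longrightarrow>
      emeasure \<rho> (B \<inter> \<Theta>) = (\<integral>\<^sup>+x. indicator (B \<inter> \<Theta>) x * q (G x) \<partial>\<mu>)"
    and dis: "disintegration \<Theta> G \<rho> \<kappa>" "disintegration \<Theta> G \<mu> U"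
  shows "AE y in pushforward \<Theta> G \<rho>. \<kappa> y = U y"
proof -
  let ?\<nu> = "pushforward \<Theta> G \<rho>" and ?\<nu>\<mu> = "pushforward \<Theta> G \<mu>"
  have sets_\<nu>: "sets ?\<nu> = sets borel" and sets_\<nu>\<mu>: "sets ?\<nu>\<mu> = sets borel"
    by (simp_all add: pushforward_def)
  have \<kappa>: "\<kappa> \<in> borel \<rightarrow>\<^sub>M prob_algebra borel" and U: "U \<in> borel \<rightarrow>\<^sub>M prob_algebra borel"
    using dis unfolding disintegration_def by auto
  have pre: "\<exists>B\<in>sets borel. G -` C \<inter> \<Theta> = B \<inter> \<Theta>" if "C \<in> sets borel" for C
    using measurable_sets[OF G that] by (auto simp: sets_restrict_space space_restrict_space)
  have key: "(\<integral>\<^sup>+x. indicator (B \<inter> \<Theta>) x * indicator C (G x) \<partial>\<rho>)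
      = (\<integral>\<^sup>+x. indicator (B \<inter> \<Theta>) x * (q (G x) * indicator C (G x)) \<partial>\<mu>)"
    if B[measurable]: "B \<in> sets borel" and C[measurable]: "C \<in> sets borel" for B C
  proof -
    obtain D where D[measurable]: "D \<in> sets borel" and GD: "G -` C \<inter> \<Theta> = D \<inter> \<Theta>"
      using pre[OF C] by blast
    have ind: "indicator (B \<inter> \<Theta>) x * indicator C (G x) = (indicator ((B \<inter> D) \<inter> \<Theta>) x :: ennreal)" for x
      using GD by (auto split: split_indicator)
    have "(\<integral>\<^sup>+x. indicator (B \<inter> \<Theta>) x * indicator C (G x) \<partial>\<rho>) = emeasure \<rho> ((B \<inter> D) \<inter> \<Theta>)"
      unfolding ind by (rule nn_integral_indicator) (simp add: \<rho>)
    also have "\<dots> = (\<integral>\<^sup>+x. indicator ((B \<inter> D) \<inter> \<Theta>) x * q (G x) \<partial>\<mu>)"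
      by (rule \<rho>_eq) measurable
    also have "\<dots> = (\<integral>\<^sup>+x. indicator (B \<inter> \<Theta>) x * (q (G x) * indicator C (G x)) \<partial>\<mu>)"
      unfolding ind[symmetric] by (simp add: ac_simps)
    finally show ?thesis .
  qed
  \<comment> \<open>The kernels have total mass 1, so the image measures are recovered by taking \<open>B = UNIV\<close>.\<close>
  have \<nu>_dens: "?\<nu> = density ?\<nu>\<mu> q"
  proof (rule measure_eqI)
    fix C assume "C \<in> sets ?\<nu>"
    then have C[measurable]: "C \<in> sets borel" by (simp add: sets_\<nu>)
    have one: "emeasure (K y) UNIV = 1" if "K \<in> borel \<rightarrow>\<^sub>M prob_algebra borel" for K :: "_ \<Rightarrow> 'a measure" and y
    proof -
      have "prob_space (K y)" "space (K y) = UNIV"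
        using measurable_space[OF that, of y]
        by (auto simp: space_prob_algebra dest: sets_eq_imp_space_eq)
      then show ?thesis using prob_space.emeasure_space_1 by metis
    qed
    have "emeasure ?\<nu> C = (\<integral>\<^sup>+y. emeasure (\<kappa> y) UNIV * indicator C y \<partial>?\<nu>)"
      by (simp add: one[OF \<kappa>] sets_\<nu> C)
    also have "\<dots> = (\<integral>\<^sup>+x. indicator (UNIV \<inter> \<Theta>) x * indicator C (G x) \<partial>\<rho>)"
      by (rule nn_integral_disintegration[OF \<Theta> G \<rho> dis(1), symmetric]) measurable
    also have "\<dots> = (\<integral>\<^sup>+x. indicator (UNIV \<inter> \<Theta>) x * (q (G x) * indicator C (G x)) \<partial>\<mu>)"
      by (rule key) measurable
    also have "\<dots> = (\<integral>\<^sup>+y. emeasure (U y) UNIV * (q y * indicator C y) \<partial>?\<nu>\<mu>)"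
      by (rule nn_integral_disintegration[OF \<Theta> G \<mu> dis(2)]) measurable
    also have "\<dots> = emeasure (density ?\<nu>\<mu> q) C"
      by (subst emeasure_density) (simp_all add: one[OF U] sets_\<nu>\<mu> C cong: measurable_cong_sets)
    finally show "emeasure ?\<nu> C = emeasure (density ?\<nu>\<mu> q) C" .
  qed (simp add: sets_\<nu> sets_\<nu>\<mu>)
  show ?thesis
  proof (rule AE_kernels_eqI[OF fin])
    show "\<kappa> \<in> ?\<nu> \<rightarrow>\<^sub>M prob_algebra borel" "U \<in> ?\<nu> \<rightarrow>\<^sub>M prob_algebra borel"
      using \<kappa> U by (simp_all add: sets_\<nu> cong: measurable_cong_sets)
  next
    fix B :: "'a set" and C assume B[measurable]: "B \<in> sets borel" and "C \<in> sets ?\<nu>"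
    then have C[measurable]: "C \<in> sets borel" by (simp add: sets_\<nu>)
    have [measurable]: "(\<lambda>y. emeasure (U y) B) \<in> borel_measurable borel"
      using measurable_emeasure_kernel[OF measurable_prob_algebraD[OF U] B] .
    have "(\<integral>\<^sup>+y. emeasure (\<kappa> y) B * indicator C y \<partial>?\<nu>)
        = (\<integral>\<^sup>+x. indicator (B \<inter> \<Theta>) x * indicator C (G x) \<partial>\<rho>)"
      by (rule nn_integral_disintegration[OF \<Theta> G \<rho> dis(1), symmetric]) measurable
    also have "\<dots> = (\<integral>\<^sup>+x. indicator (B \<inter> \<Theta>) x * (q (G x) * indicator C (G x)) \<partial>\<mu>)"
      by (rule key) measurable
    also have "\<dots> = (\<integral>\<^sup>+y. emeasure (U y) B * (q y * indicator C y) \<partial>?\<nu>\<mu>)"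
      by (rule nn_integral_disintegration[OF \<Theta> G \<mu> dis(2)]) measurable
    also have "\<dots> = (\<integral>\<^sup>+y. q y * (emeasure (U y) B * indicator C y) \<partial>?\<nu>\<mu>)"
      by (simp add: ac_simps)
    also have "\<dots> = (\<integral>\<^sup>+y. emeasure (U y) B * indicator C y \<partial>density ?\<nu>\<mu> q)"
      by (rule nn_integral_density[symmetric]) (simp_all add: sets_\<nu>\<mu> cong: measurable_cong_sets)
    finally show "(\<integral>\<^sup>+y. emeasure (\<kappa> y) B * indicator C y \<partial>?\<nu>)
        = (\<integral>\<^sup>+y. emeasure (U y) B * indicator C y \<partial>?\<nu>)"
      unfolding \<nu>_dens .
  qed
qed

section \<open>Lebesgue densities and negative entropy\<close>

lemma restrict_space_density:
  assumes \<Theta>: "\<Theta> \<in> sets M" and f[measurable]: "f \<in> borel_measurable M"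
  shows "restrict_space (density M f) \<Theta> = density (restrict_space M \<Theta>) f"
proof (rule measure_eqI)
  show "sets (restrict_space (density M f) \<Theta>) = sets (density (restrict_space M \<Theta>) f)"
    by (simp add: sets_restrict_space)
next
  fix A assume "A \<in> sets (restrict_space (density M f) \<Theta>)"
  then have A: "A \<subseteq> \<Theta>" "A \<in> sets M"
    using \<Theta> by (auto simp: sets_restrict_space)
  have A': "A \<in> sets (restrict_space M \<Theta>)" using A \<Theta> by (simp add: sets_restrict_space_iff)
  have [measurable]: "f \<in> borel_measurable (restrict_space M \<Theta>)"
    by (rule measurable_restrict_space1) measurable
  have "emeasure (restrict_space (density M f) \<Theta>) A = (\<integral>\<^sup>+x. f x * indicator A x \<partial>M)"
    using A \<Theta> by (simp add: emeasure_restrict_space emeasure_density)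
  also have "\<dots> = (\<integral>\<^sup>+x. f x * indicator A x * indicator \<Theta> x \<partial>M)"
    using A by (intro nn_integral_cong) (auto split: split_indicator)
  also have "\<dots> = emeasure (density (restrict_space M \<Theta>) f) A"
    using A' \<Theta> by (simp add: emeasure_density nn_integral_restrict_space)
  finally show "emeasure (restrict_space (density M f) \<Theta>) A = emeasure (density (restrict_space M \<Theta>) f) A" .
qed

lemma borel_measurable_lebesgue_density[measurable]:
  "lebesgue_density \<mu> \<in> borel_measurable borel"
  unfolding lebesgue_density_def[abs_def] by measurable

lemma lebesgue_density_nonneg: "0 \<le> lebesgue_density \<mu> x"
  by (simp add: lebesgue_density_def)

lemma density_lebesgue_density:
  fixes \<mu> :: "'a::euclidean_space measure"
  assumes \<mu>: "sets \<mu> = sets borel" "finite_measure \<mu>" "absolutely_continuous lborel \<mu>"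
  shows "density lborel (\<lambda>x. ennreal (lebesgue_density \<mu> x)) = \<mu>"
proof -
  interpret finite_measure \<mu> by fact
  have sig: "sigma_finite_measure \<mu>" ..
  have "AE x in lborel. RN_deriv lborel \<mu> x \<noteq> \<infinity>"
    using sigma_finite_measure.RN_deriv_finite[OF lborel.sigma_finite_measure_axioms sig] \<mu> by simp
  then have "AE x in lborel. ennreal (lebesgue_density \<mu> x) = RN_deriv lborel \<mu> x"
    by eventually_elim (simp add: lebesgue_density_def less_top)
  then have "density lborel (\<lambda>x. ennreal (lebesgue_density \<mu> x)) = density lborel (RN_deriv lborel \<mu>)"
    by (intro density_cong) measurable
  also have "\<dots> = \<mu>" using \<mu> by (intro sigma_finite_measure.density_RN_deriv[OF lborel.sigma_finite_measure_axioms]) auto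
  finally show ?thesis .
qed

lemma lebesgue_density_density:
  fixes f :: "'a::euclidean_space \<Rightarrow> real"
  assumes f: "f \<in> borel_measurable borel" "\<And>x. 0 \<le> f x"
  shows "AE x in lborel. lebesgue_density (density lborel f) x = f x"
proof -
  have "AE x in lborel. ennreal (f x) = RN_deriv lborel (density lborel f) x"
    using f by (intro sigma_finite_measure.RN_deriv_unique[OF lborel.sigma_finite_measure_axioms]) auto
  then show ?thesis
  proof eventually_elim
    case (elim x)
    then show ?case using f(2)[of x] unfolding lebesgue_density_def elim[symmetric] by simp
  qed
qed

lemma neg_xlnx_le_one:
  fixes t :: real
  assumes "0 \<le> t"
  shows "- (t * ln t) \<le> 1"
  using gibbs_pointwise(1)[OF assms, of 1] assms by simp

text \<open>
  For an integrable integrand both parts of the extended-real difference are finite, and it becomes an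
  ordinary Lebesgue integral.
\<close>

lemma neg_entropy_eq_integral:
  assumes \<Theta>: "\<Theta> \<in> sets borel"
    and int: "integrable (restrict_space lborel \<Theta>) (\<lambda>x. lebesgue_density \<rho> x * ln (lebesgue_density \<rho> x))"
  shows "neg_entropy \<Theta> \<rho>
    = ereal (\<integral>x. lebesgue_density \<rho> x * ln (lebesgue_density \<rho> x) \<partial>restrict_space lborel \<Theta>)"
proof -
  have fin: "enn2ereal p - enn2ereal n = ereal (enn2real p - enn2real n)"
    if "p \<noteq> \<infinity>" "n \<noteq> \<infinity>" for p n :: ennreal
    using that by (cases p; cases n) (auto simp: enn2ereal_ennreal)
  show ?thesis
    using int unfolding neg_entropy_def real_lebesgue_integral_def[OF int] real_integrable_def
    using \<Theta> by (subst fin) (auto simp: nn_integral_restrict_space)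
qed

text \<open>
  The negative part of \<open>t ln t\<close> is bounded, so on a set of finite volume only the positive part could
  have infinite integral.
\<close>

lemma integrable_of_finite_neg_entropy:
  assumes \<Theta>: "\<Theta> \<in> sets borel" and vol: "emeasure lborel \<Theta> < \<infinity>"
    and fin: "neg_entropy \<Theta> \<rho> < \<infinity>"
  shows "integrable (restrict_space lborel \<Theta>) (\<lambda>x. lebesgue_density \<rho> x * ln (lebesgue_density \<rho> x))"
proof -
  let ?e = "\<lambda>x. lebesgue_density \<rho> x * ln (lebesgue_density \<rho> x)"
  have "(\<integral>\<^sup>+x\<in>\<Theta>. ennreal (- ?e x) \<partial>lborel) \<le> (\<integral>\<^sup>+x. indicator \<Theta> x \<partial>lborel)"
    using neg_xlnx_le_one[OF lebesgue_density_nonneg[of \<rho>]]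
    by (intro nn_integral_mono) (auto split: split_indicator)
  also have "\<dots> < \<infinity>" using vol \<Theta> by simp
  finally have neg: "(\<integral>\<^sup>+x\<in>\<Theta>. ennreal (- ?e x) \<partial>lborel) < \<infinity>" .
  have imp: "p \<noteq> \<infinity>" if "enn2ereal p - enn2ereal n < \<infinity>" "n < \<infinity>" for p n :: ennreal
    using that by (cases p; cases n) (auto simp: enn2ereal_ennreal)
  have pos: "(\<integral>\<^sup>+x\<in>\<Theta>. ennreal (?e x) \<partial>lborel) \<noteq> \<infinity>"
    using imp[OF fin[unfolded neg_entropy_def] neg] .
  have "?e \<in> borel_measurable (restrict_space lborel \<Theta>)"
    by (rule measurable_restrict_space1) measurable
  then show ?thesis
    unfolding real_integrable_def using pos neg \<Theta> by (simp add: nn_integral_restrict_space less_top)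
qed

section \<open>The optimal density\<close>

text \<open>
  Competitors are densities on the restricted space \<open>\<Theta>\<close>, whereas feasible measures live on the ambient
  space. The total mass need not be checked separately: it is the mass of the image.
\<close>

lemma feasible_extension_by_zero:
  fixes g :: "'a::euclidean_space \<Rightarrow> real" and G :: "'a \<Rightarrow> 'b::euclidean_space"
  assumes \<Theta>[measurable]: "\<Theta> \<in> sets borel"
    and G: "G \<in> restrict_space borel \<Theta> \<rightarrow>\<^sub>M borel"
    and prob: "prob_space \<rho>y"
    and g: "g \<in> borel_measurable (restrict_space lborel \<Theta>)" and g0: "\<And>x. 0 \<le> g x"
    and push: "distr (density (restrict_space lborel \<Theta>) g) borel G = \<rho>y"
  shows "feasible \<Theta> G \<rho>y (density lborel (\<lambda>x. indicator \<Theta> x * g x))"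
proof -
  let ?g = "\<lambda>x. indicator \<Theta> x * g x" and ?M = "restrict_space lborel \<Theta>"
  let ?\<rho> = "density lborel (\<lambda>x. ennreal (?g x))"
  have g'[measurable]: "?g \<in> borel_measurable borel"
    using g by (subst (asm) borel_measurable_restrict_space_iff) auto
  have GM[measurable]: "G \<in> ?M \<rightarrow>\<^sub>M borel"
    using G by (simp cong: measurable_cong_sets sets_restrict_space_cong)
  have dens: "density ?M (\<lambda>x. ennreal (?g x)) = density ?M g"
  proof (rule density_cong)
    show "AE x in ?M. ennreal (?g x) = ennreal (g x)"
      by (rule AE_I2) (simp add: space_restrict_space)
  qed (use g in \<open>auto intro!: measurable_restrict_space1\<close>)
  have pf: "pushforward \<Theta> G ?\<rho> = \<rho>y"
    unfolding pushforward_def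
    by (subst restrict_space_density) (auto simp: dens push)
  have on: "AE x in ?\<rho>. x \<in> \<Theta>"
    by (subst AE_density) (auto split: split_indicator)
  have "emeasure ?\<rho> UNIV = emeasure \<rho>y (space \<rho>y)"
  proof -
    have "emeasure ?\<rho> UNIV = (\<integral>\<^sup>+x. ennreal (g x) * indicator \<Theta> x \<partial>lborel)"
      by (subst emeasure_density) (auto intro!: nn_integral_cong split: split_indicator)
    also have "\<dots> = emeasure (density ?M g) (space ?M)"
      using g by (subst emeasure_density[OF _ sets.top])
        (auto simp: nn_integral_restrict_space space_restrict_space intro!: nn_integral_cong split: split_indicator)
    also have "\<dots> = emeasure \<rho>y (space \<rho>y)"
      unfolding push[symmetric] by (subst emeasure_distr) (auto simp: space_restrict_space)
    finally show ?thesis .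
  qed
  then have "prob_space ?\<rho>"
    using prob_space.emeasure_space_1[OF prob] by (intro prob_spaceI) simp
  moreover have "absolutely_continuous lborel ?\<rho>"
    by (rule absolutely_continuousI_density) measurable
  ultimately show ?thesis
    unfolding feasible_def P_ac_def using pf on by simp
qed

text \<open>
  A null set of values of \<open>G\<close> has a null preimage, so \<open>\<rho>y\<close> is absolutely continuous with respect to the
  image \<open>\<nu>\<close> of Lebesgue measure, even if \<open>\<nu>\<close> is singular, and the general factorization theorem applies.
\<close>

theorem entropy_optimizer_density:
  fixes \<Theta> :: "'a::euclidean_space set" and G :: "'a \<Rightarrow> 'b::euclidean_space"
  assumes \<Theta>[measurable]: "\<Theta> \<in> sets borel" and vol: "emeasure lborel \<Theta> < \<infinity>"
    and G: "G \<in> restrict_space borel \<Theta> \<rightarrow>\<^sub>M borel"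
    and opt: "is_arg_min (neg_entropy \<Theta>) (feasible \<Theta> G \<rho>y) \<rho>"
    and fin: "neg_entropy \<Theta> \<rho> < \<infinity>"
  obtains h :: "'b \<Rightarrow> real" where
    "h \<in> borel_measurable borel" "\<And>y. 0 \<le> h y"
    "\<rho>y = density (pushforward \<Theta> G lborel) h"
    "AE x in lborel. x \<in> \<Theta> \<longrightarrow> lebesgue_density \<rho> x = h (G x)"
proof -
  let ?M = "restrict_space lborel \<Theta>" and ?f = "lebesgue_density \<rho>"
  define \<nu> where "\<nu> = pushforward \<Theta> G lborel"
  have feas: "feasible \<Theta> G \<rho>y \<rho>" and best: "\<And>\<rho>'. feasible \<Theta> G \<rho>y \<rho>' \<Longrightarrow> \<not> neg_entropy \<Theta> \<rho>' < neg_entropy \<Theta> \<rho>"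
    using opt unfolding is_arg_min_def by auto
  have \<rho>: "sets \<rho> = sets borel" "prob_space \<rho>" "absolutely_continuous lborel \<rho>"
    and push: "pushforward \<Theta> G \<rho> = \<rho>y"
    using feas unfolding feasible_def P_ac_def by auto
  interpret \<rho>: prob_space \<rho> by fact
  have f_dens: "density lborel ?f = \<rho>"
    using \<rho> by (intro density_lebesgue_density) (auto intro: \<rho>.finite_measure_axioms)
  have GM[measurable]: "G \<in> ?M \<rightarrow>\<^sub>M borel"
    using G by (simp cong: measurable_cong_sets sets_restrict_space_cong)
  have f[measurable]: "?f \<in> borel_measurable ?M"
    by (rule measurable_restrict_space1) measurable
  have finM: "finite_measure ?M"
    using vol by (intro finite_measureI) (simp add: space_restrict_space emeasure_restrict_space less_top)
  interpret M: finite_measure ?M by fact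
  have \<nu>_distr: "\<nu> = distr ?M borel G" by (simp add: \<nu>_def pushforward_def)
  have \<rho>y_distr: "distr (density ?M ?f) borel G = \<rho>y"
    unfolding push[symmetric] pushforward_def
    by (subst f_dens[symmetric], subst restrict_space_density) auto
  have f_int: "integrable ?M ?f"
  proof (rule integrableI_nonneg)
    have "(\<integral>\<^sup>+x. ennreal (?f x) \<partial>?M) \<le> (\<integral>\<^sup>+x. ennreal (?f x) \<partial>lborel)"
      by (subst nn_integral_restrict_space) (auto intro!: nn_integral_mono split: split_indicator)
    also have "\<dots> = emeasure (density lborel ?f) (space lborel)"
      by (subst emeasure_density) auto
    also have "\<dots> < \<infinity>" unfolding f_dens using \<rho>.emeasure_finite by (simp add: less_top[symmetric])
    finally show "(\<integral>\<^sup>+x. ennreal (?f x) \<partial>?M) < \<infinity>" .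
  qed (auto simp: lebesgue_density_nonneg)
  have sets_\<rho>y: "sets \<rho>y = sets borel" unfolding \<rho>y_distr[symmetric] by simp
  have prob_y: "prob_space \<rho>y"
  proof
    have "AE x in \<rho>. x \<in> \<Theta>" using feas by (simp add: feasible_def P_ac_def)
    then have "emeasure \<rho> \<Theta> = 1"
      using \<rho>(1) by (intro \<rho>.emeasure_eq_1_AE) simp_all
    moreover have "emeasure \<rho>y (space \<rho>y) = emeasure \<rho> \<Theta>"
    proof -
      have "G \<in> restrict_space \<rho> \<Theta> \<rightarrow>\<^sub>M borel"
        using G \<rho>(1) by (simp cong: measurable_cong_sets sets_restrict_space_cong)
      then show ?thesis unfolding push[symmetric] pushforward_def
        using \<rho>(1) sets_eq_imp_space_eq[OF \<rho>(1)]
        by (subst emeasure_distr) (auto simp: space_restrict_space emeasure_restrict_space)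
    qed
    ultimately show "emeasure \<rho>y (space \<rho>y) = 1" by simp
  qed
  interpret \<rho>y: prob_space \<rho>y by fact
  have \<nu>_fin: "finite_measure \<nu>" unfolding \<nu>_distr by (rule M.finite_measure_distr) measurable
  interpret \<nu>: finite_measure \<nu> by fact
  have sets_\<nu>: "sets \<nu> = sets borel" by (simp add: \<nu>_distr)
  have ac: "absolutely_continuous \<nu> \<rho>y"
    unfolding absolutely_continuous_def
  proof
    fix C assume "C \<in> null_sets \<nu>"
    then have C[measurable]: "C \<in> sets borel" and "AE y in \<nu>. y \<notin> C"
      using sets_\<nu> by (auto simp: AE_not_in)
    then have "AE x in ?M. G x \<notin> C" unfolding \<nu>_distr using AE_distrD[OF GM] by auto
    then have "AE x in density ?M ?f. G x \<notin> C" by (subst AE_density) auto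
    then have "AE y in \<rho>y. y \<notin> C"
      unfolding \<rho>y_distr[symmetric] by (subst AE_distr_iff) auto
    then show "C \<in> null_sets \<rho>y" using C sets_\<rho>y by (simp add: AE_iff_null_sets)
  qed
  define h where "h y = enn2real (RN_deriv \<nu> \<rho>y y)" for y
  have h\<nu>: "h \<in> borel_measurable \<nu>" unfolding h_def[abs_def] by measurable
  then have h[measurable]: "h \<in> borel_measurable borel"
    by (simp add: sets_\<nu> cong: measurable_cong_sets)
  have h0: "0 \<le> h y" for y by (simp add: h_def)
  have sy: "sets \<rho>y = sets \<nu>" by (simp add: sets_\<nu> sets_\<rho>y)
  have h_dens: "\<rho>y = density \<nu> h"
  proof -
    have "AE y in \<nu>. RN_deriv \<nu> \<rho>y y \<noteq> \<infinity>"
      by (rule \<nu>.RN_deriv_finite[OF \<rho>y.sigma_finite_measure_axioms ac sy])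
    then have "AE y in \<nu>. RN_deriv \<nu> \<rho>y y = ennreal (h y)"
      by eventually_elim (simp add: h_def less_top)
    then have "density \<nu> (RN_deriv \<nu> \<rho>y) = density \<nu> h"
      using h\<nu> by (intro density_cong) auto
    then show ?thesis using \<nu>.density_RN_deriv[OF ac sy] by simp
  qed
  have ent: "integrable ?M (\<lambda>x. ?f x * ln (?f x))"
    by (rule integrable_of_finite_neg_entropy[OF \<Theta> vol fin])
  have "AE x in ?M. ?f x = h (G x)"
  proof (rule entropy_minimizer_factors[OF finM GM f lebesgue_density_nonneg f_int ent h h0])
    show "distr (density ?M ?f) borel G = density (distr ?M borel G) h"
      unfolding \<rho>y_distr \<nu>_distr[symmetric] by (rule h_dens)
  next
    fix g :: "'a \<Rightarrow> real"
    assume g: "g \<in> borel_measurable ?M" "\<And>x. 0 \<le> g x" "integrable ?M (\<lambda>x. g x * ln (g x))"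
      and g_push: "distr (density ?M g) borel G = distr (density ?M ?f) borel G"
    define \<rho>' where "\<rho>' = density lborel (\<lambda>x. ennreal (indicator \<Theta> x * g x))"
    have "(\<lambda>x. indicator \<Theta> x * g x) \<in> borel_measurable borel"
      using g(1) by (subst (asm) borel_measurable_restrict_space_iff) auto
    then have "AE x in lborel. lebesgue_density \<rho>' x = indicator \<Theta> x * g x"
      unfolding \<rho>'_def using g(2) by (intro lebesgue_density_density) auto
    then have ae: "AE x in ?M. lebesgue_density \<rho>' x = g x"
      by (subst AE_restrict_space_iff) auto
    have [measurable]: "lebesgue_density \<rho>' \<in> borel_measurable ?M"
      by (rule measurable_restrict_space1) measurable
    note g(1)[measurable]
    let ?e = "\<lambda>x. lebesgue_density \<rho>' x * ln (lebesgue_density \<rho>' x)"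
    have ae': "AE x in ?M. ?e x = g x * ln (g x)" using ae by eventually_elim simp
    have int': "integrable ?M ?e"
      using g(3) ae' by (subst integrable_cong_AE[OF _ _ ae']) auto
    have val': "(\<integral>x. ?e x \<partial>?M) = (\<integral>x. g x * ln (g x) \<partial>?M)"
      using ae' by (intro integral_cong_AE) auto
    have "feasible \<Theta> G \<rho>y \<rho>'"
      unfolding \<rho>'_def using g g_push \<rho>y_distr
      by (intro feasible_extension_by_zero[OF \<Theta> G prob_y]) auto
    from best[OF this] have "neg_entropy \<Theta> \<rho> \<le> neg_entropy \<Theta> \<rho>'" by simp
    then show "(\<integral>x. ?f x * ln (?f x) \<partial>?M) \<le> (\<integral>x. g x * ln (g x) \<partial>?M)"
      by (simp add: neg_entropy_eq_integral[OF \<Theta> ent] neg_entropy_eq_integral[OF \<Theta> int'] val')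
  qed
  then have "AE x in lborel. x \<in> \<Theta> \<longrightarrow> ?f x = h (G x)"
    by (subst (asm) AE_restrict_space_iff) auto
  with that[OF h h0] h_dens show thesis unfolding \<nu>_def by blast
qed

section \<open>Conditional distributions and density of the optimizer\<close>

theorem theorem3p1:
  fixes \<Theta> :: "(real ^ 'm) set"
    and G :: "real ^ 'm \<Rightarrow> real ^ 'n"
    and \<rho>y :: "(real ^ 'n) measure"
    and \<rho>star :: "(real ^ 'm) measure"
  assumes "compact \<Theta>" and "\<Theta> \<subset> UNIV"
    and "G \<in> restrict_space borel \<Theta> \<rightarrow>\<^sub>M borel"
    and "\<rho>y \<in> P_ac (G ` \<Theta>)"
    and "is_arg_min (neg_entropy \<Theta>) (feasible \<Theta> G \<rho>y) \<rho>star"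
    and "neg_entropy \<Theta> \<rho>star < \<infinity>"
  shows "(\<forall>\<kappa> U. disintegration \<Theta> G \<rho>star \<kappa> \<longrightarrow> uniform_on_level_sets \<Theta> G U
              \<longrightarrow> (AE y in \<rho>y. \<kappa> y = U y))
       \<and> (absolutely_continuous lborel (pushforward \<Theta> G lborel)
              \<longrightarrow> (AE x in lborel. x \<in> \<Theta>
                    \<longrightarrow> lebesgue_density \<rho>star x = lebesgue_density \<rho>y (G x) / level_density \<Theta> G (G x)))"
proof -
  let ?M = "restrict_space lborel \<Theta>" and ?f = "lebesgue_density \<rho>star"
  define \<nu> where "\<nu> = pushforward \<Theta> G lborel"
  have \<Theta>[measurable]: "\<Theta> \<in> sets borel" using \<open>compact \<Theta>\<close> by (rule borel_compact)
  have vol: "emeasure lborel \<Theta> < \<infinity>"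
    using emeasure_bounded_finite[OF compact_imp_bounded[OF \<open>compact \<Theta>\<close>]] by simp
  note G = \<open>G \<in> restrict_space borel \<Theta> \<rightarrow>\<^sub>M borel\<close>
  have GM[measurable]: "G \<in> ?M \<rightarrow>\<^sub>M borel"
    using G by (simp cong: measurable_cong_sets sets_restrict_space_cong)
  obtain h :: "real ^ 'n \<Rightarrow> real" where h[measurable]: "h \<in> borel_measurable borel"
    and h0: "\<And>y. 0 \<le> h y" and \<rho>y_dens: "\<rho>y = density \<nu> h"
    and f_eq: "AE x in lborel. x \<in> \<Theta> \<longrightarrow> ?f x = h (G x)"
    using entropy_optimizer_density[OF \<Theta> vol G assms(5,6)] unfolding \<nu>_def by blast
  have \<rho>: "sets \<rho>star = sets borel" "prob_space \<rho>star" "absolutely_continuous lborel \<rho>star"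
    and on: "AE x in \<rho>star. x \<in> \<Theta>" and push: "pushforward \<Theta> G \<rho>star = \<rho>y"
    using assms(5) unfolding is_arg_min_def feasible_def P_ac_def by auto
  interpret \<rho>: prob_space \<rho>star by fact
  have prob_y: "prob_space \<rho>y" using assms(4) by (simp add: P_ac_def)
  have f_dens: "density lborel ?f = \<rho>star"
    using \<rho> by (intro density_lebesgue_density) (auto intro: \<rho>.finite_measure_axioms)

  have conditional: "AE y in \<rho>y. \<kappa> y = U y"
    if \<kappa>: "disintegration \<Theta> G \<rho>star \<kappa>" and U: "uniform_on_level_sets \<Theta> G U" for \<kappa> U
  proof -
    let ?V = "emeasure lborel \<Theta>"
    have V0: "?V \<noteq> 0"
    proof
      assume "?V = 0"
      then have "\<Theta> \<in> null_sets lborel" using \<Theta> by (simp add: null_setsI)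
      with \<rho>(3) have "\<Theta> \<in> null_sets \<rho>star" unfolding absolutely_continuous_def by (rule subsetD)
      then have "AE x in \<rho>star. x \<notin> \<Theta>" by (rule AE_not_in)
      with on have "AE x in \<rho>star. False" by eventually_elim simp
      then show False by (simp add: \<rho>.AE_False)
    qed
    have meas: "(\<lambda>x. indicator (B \<inter> \<Theta>) x * ennreal (h (G x))) \<in> borel_measurable borel"
      if [measurable]: "B \<in> sets borel" for B
    proof -
      have [measurable]: "indicator B \<in> borel_measurable ?M"
        by (rule measurable_restrict_space1) measurable
      have "(\<lambda>x. indicator B x * ennreal (h (G x))) \<in> borel_measurable ?M"
        by measurable
      then have "(\<lambda>x. indicator B x * ennreal (h (G x)) * indicator \<Theta> x) \<in> borel_measurable borel"
        by (subst (asm) borel_measurable_restrict_space_iff_ennreal) auto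
      then show ?thesis by (simp add: indicator_inter_arith ac_simps)
    qed
    \<comment> \<open>The factor \<open>?V\<close> converts densities with respect to Lebesgue measure into densities with respect to
      the normalized one.\<close>
    have "emeasure \<rho>star (B \<inter> \<Theta>)
        = (\<integral>\<^sup>+x. indicator (B \<inter> \<Theta>) x * (?V * ennreal (h (G x))) \<partial>uniform_measure lborel \<Theta>)"
      if B[measurable]: "B \<in> sets borel" for B
    proof -
      let ?I = "\<integral>\<^sup>+x. indicator (B \<inter> \<Theta>) x * ennreal (h (G x)) \<partial>lborel"
      note [measurable] = meas[OF B]
      have "emeasure \<rho>star (B \<inter> \<Theta>) = (\<integral>\<^sup>+x. ennreal (?f x) * indicator (B \<inter> \<Theta>) x \<partial>lborel)"
        by (subst f_dens[symmetric], subst emeasure_density) auto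
      also have "\<dots> = ?I"
        by (rule nn_integral_cong_AE, use f_eq in eventually_elim) (auto split: split_indicator)
      also have "\<dots> = ?V * ?I / ?V"
        using V0 vol ennreal_mult_divide_eq[of ?V ?I] by (simp add: mult.commute[of ?V] less_top)
      also have "?V * ?I = (\<integral>\<^sup>+x. ?V * (indicator (B \<inter> \<Theta>) x * ennreal (h (G x))) \<partial>lborel)"
        by (rule nn_integral_cmult[symmetric]) measurable
      also have "\<dots> = (\<integral>\<^sup>+x. ?V * (indicator (B \<inter> \<Theta>) x * ennreal (h (G x))) * indicator \<Theta> x \<partial>lborel)"
        by (intro nn_integral_cong) (auto split: split_indicator)
      also have "\<dots> / ?V
          = (\<integral>\<^sup>+x. ?V * (indicator (B \<inter> \<Theta>) x * ennreal (h (G x))) \<partial>uniform_measure lborel \<Theta>)"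
        by (rule nn_integral_uniform_measure[symmetric]) measurable
      finally show ?thesis by (simp add: ac_simps)
    qed
    then have "AE y in pushforward \<Theta> G \<rho>star. \<kappa> y = U y"
      using \<kappa> U prob_y \<rho>(1) unfolding uniform_on_level_sets_def
      by (intro disintegration_density_unique[OF \<Theta> G, where q = "\<lambda>y. ?V * ennreal (h y)"
            and \<mu> = "uniform_measure lborel \<Theta>"])
        (auto simp: push prob_space.finite_measure)
    then show ?thesis unfolding push .
  qed

  have ratio: "AE x in lborel. x \<in> \<Theta> \<longrightarrow> ?f x = lebesgue_density \<rho>y (G x) / level_density \<Theta> G (G x)"
    if ac: "absolutely_continuous lborel \<nu>"
  proof -
    let ?w = "level_density \<Theta> G"
    have w: "?w = lebesgue_density \<nu>" by (simp add: level_density_def \<nu>_def)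
    have w0: "0 \<le> ?w y" for y by (simp add: w lebesgue_density_nonneg)
    have [measurable]: "?w \<in> borel_measurable borel" unfolding w by measurable
    have "finite_measure ?M"
      using vol by (intro finite_measureI) (simp add: space_restrict_space emeasure_restrict_space less_top)
    then have "finite_measure \<nu>"
      unfolding \<nu>_def pushforward_def by (rule finite_measure.finite_measure_distr) measurable
    then have w_dens: "density lborel ?w = \<nu>"
      unfolding w using ac by (intro density_lebesgue_density) (auto simp: \<nu>_def pushforward_def)
    have "\<rho>y = density lborel (\<lambda>y. ennreal (?w y * h y))"
      unfolding \<rho>y_dens w_dens[symmetric]
      by (subst density_density_eq) (auto simp: ennreal_mult w0 h0)
    then have "AE y in lborel. lebesgue_density \<rho>y y = ?w y * h y"
      using lebesgue_density_density[of "\<lambda>y. ?w y * h y"] w0 h0 by simp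
    \<comment> \<open>Almost everywhere for \<open>\<nu>\<close> the divisor is positive, so the quotient is a genuine one.\<close>
    then have "AE y in density lborel ?w. lebesgue_density \<rho>y y / ?w y = h y"
      by (subst AE_density) (auto elim!: eventually_mono)
    then have "AE x in ?M. lebesgue_density \<rho>y (G x) / ?w (G x) = h (G x)"
      unfolding w_dens \<nu>_def pushforward_def by (rule AE_distrD[OF GM])
    then have "AE x in lborel. x \<in> \<Theta> \<longrightarrow> lebesgue_density \<rho>y (G x) / ?w (G x) = h (G x)"
      by (subst (asm) AE_restrict_space_iff) auto
    with f_eq show ?thesis by eventually_elim simp
  qed
  show ?thesis using conditional ratio unfolding \<nu>_def by blast
qed

end
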